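(* Let $m:\mathbb{R}\to\mathbb{R}$ be locally uniformly continuous. Let $u:\mathbb{H}\times[0,\infty)\to\mathbb{R}$ be the unique continuous viscosity solution, bounded on $\mathbb{H}\times[0,T)$ for every $T>0$, of $$u_t+m(|\nabla_Hu|)=0\quad\text{in }\mathbb{H}\times(0,\infty)$$ with $u(\cdot,0)=u_0$ bounded in $\mathbb{H}$. If $u_0$ is Lipschitz with respect to $d_L$ in $\mathbb{H}$, i.e. there exists $L>0$ such that $|u_0(p)-u_0(q)|\le L\,d_L(p,q)$ for all $p,q\in\mathbb{H}$, then for all $t\ge0$ $$|u(p,t)-u(q,t)|\le L\,d_L(p,q)$$ for all $p,q\in\mathbb{H}$.
   Context: The Heisenberg group $\mathbb{H}$ is $\mathbb{R}^3$ with the group law $(x_p,y_p,z_p)\cdot(x_q,y_q,z_q)=\left(x_p+x_q,\,y_p+y_q,\,z_p+z_q+\tfrac12(x_py_q-x_qy_p)\right)$; the inverse of $p=(x,y,z)$ is $p^{-1}=(-x,-y,-z)$. The Korányi gauge is $|p|_G=\left((x^2+y^2)^2+16z^2\right)^{1/4}$ for $p=(x,y,z)$, and the left-invariant gauge metric is $d_L(p,q)=|p^{-1}\cdot q|_G$. Left-invariant vector fields: $X_1=\partial_x-\tfrac y2\partial_z$, $X_2=\partial_y+\tfrac x2\partial_z$. The horizontal gradient (in the space variable) is $\nabla_Hu=(X_1u,X_2u)$, and $|\nabla_Hu|$ is its Euclidean norm in $\mathbb{R}^2$. Viscosity notions: a continuous function $u$ is a viscosity subsolution (resp. supersolution) of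 $u_t+m(|\nabla_Hu|)=0$ in $\mathbb{H}\times(0,\infty)$ if, whenever $\phi$ is a $C^2$ function near $(p_0,t_0)\in\mathbb{H}\times(0,\infty)$ and $u-\phi$ has a local maximum (resp. minimum) at $(p_0,t_0)$, one has $\phi_t+m(|\nabla_H\phi|)\le0$ (resp. $\ge0$) at $(p_0,t_0)$. A viscosity solution is both. *)

theory Defs
  imports "HOL-Analysis.Analysis"
begin

text \<open>The Heisenberg group is carried by \<open>\<real>\<^sup>3\<close>, represented as a product so that
  points are triples \<open>(x, y, z)\<close>. The norm, metric and addition of the type are the Euclidean
  ones; only the topology and the differential calculus they induce are used. The group law and
  the gauge metric are the separate constants below.\<close>

type_synonym heis = "real \<times> real \<times> real"

fun heis_mult :: "heis \<Rightarrow> heis \<Rightarrow> heis" where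
  "heis_mult (x1, y1, z1) (x2, y2, z2) =
     (x1 + x2, y1 + y2, z1 + z2 + (1/2) * (x1 * y2 - x2 * y1))"

fun heis_inv :: "heis \<Rightarrow> heis" where
  "heis_inv (x, y, z) = (- x, - y, - z)"

fun koranyi_gauge :: "heis \<Rightarrow> real" where
  "koranyi_gauge (x, y, z) = root 4 ((x\<^sup>2 + y\<^sup>2)\<^sup>2 + 16 * z\<^sup>2)"

definition dL :: "heis \<Rightarrow> heis \<Rightarrow> real" where
  "dL p q = koranyi_gauge (heis_mult (heis_inv p) q)"

fun X1 :: "(heis \<Rightarrow> real) \<Rightarrow> heis \<Rightarrow> real" where
  "X1 f (x, y, z) = deriv (\<lambda>s. f (s, y, z)) x - (y / 2) * deriv (\<lambda>s. f (x, y, s)) z"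

fun X2 :: "(heis \<Rightarrow> real) \<Rightarrow> heis \<Rightarrow> real" where
  "X2 f (x, y, z) = deriv (\<lambda>s. f (x, s, z)) y + (x / 2) * deriv (\<lambda>s. f (x, y, s)) z"

text \<open>The norm on \<^typ>\<open>real \<times> real\<close> is the Euclidean one.\<close>

definition horizontal_gradient :: "(heis \<Rightarrow> real) \<Rightarrow> heis \<Rightarrow> real \<times> real" where
  "horizontal_gradient f p = (X1 f p, X2 f p)"

text \<open>Twice continuously Frechet differentiable on some open neighbourhood of the point.\<close>

definition C2_near :: "('a::real_normed_vector \<Rightarrow> real) \<Rightarrow> 'a \<Rightarrow> bool" where
  "C2_near f a \<longleftrightarrow>
     (\<exists>U (f' :: 'a \<Rightarrow> 'a \<Rightarrow>\<^sub>L real) (f'' :: 'a \<Rightarrow> 'a \<Rightarrow>\<^sub>L 'a \<Rightarrow>\<^sub>L real).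
        open U \<and> a \<in> U \<and>
        (\<forall>x\<in>U. (f has_derivative blinfun_apply (f' x)) (at x)) \<and>
        (\<forall>x\<in>U. (f' has_derivative blinfun_apply (f'' x)) (at x)) \<and>
        continuous_on U f'')"

text \<open>The left-hand side of \<open>u\<^sub>t + m(|\<nabla>\<^sub>H u|) = 0\<close>, evaluated on a smooth function.\<close>

definition hj_operator :: "(real \<Rightarrow> real) \<Rightarrow> (heis \<times> real \<Rightarrow> real) \<Rightarrow> heis \<Rightarrow> real \<Rightarrow> real" where
  "hj_operator m \<phi> p t =
     deriv (\<lambda>s. \<phi> (p, s)) t + m (norm (horizontal_gradient (\<lambda>q. \<phi> (q, t)) p))"

text \<open>A function on \<open>H \<times> [0, \<infinity>)\<close> is given as a total function on
  \<^typ>\<open>heis \<times> real\<close>. Since contact points have \<open>t\<^sub>0 > 0\<close>, a neighbourhood of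
  \<open>(p\<^sub>0, t\<^sub>0)\<close> can always be shrunk into \<open>H \<times> (0, \<infinity>)\<close>, so the values at negative times
  do not matter.\<close>

definition viscosity_subsolution :: "(real \<Rightarrow> real) \<Rightarrow> (heis \<times> real \<Rightarrow> real) \<Rightarrow> bool" where
  "viscosity_subsolution m u \<longleftrightarrow>
     continuous_on (UNIV \<times> {0<..}) u \<and>
     (\<forall>\<phi> p0 t0. t0 > 0 \<longrightarrow> C2_near \<phi> (p0, t0) \<longrightarrow>
        (\<forall>\<^sub>F z in nhds (p0, t0). u z - \<phi> z \<le> u (p0, t0) - \<phi> (p0, t0)) \<longrightarrow>
        hj_operator m \<phi> p0 t0 \<le> 0)"

definition viscosity_supersolution :: "(real \<Rightarrow> real) \<Rightarrow> (heis \<times> real \<Rightarrow> real) \<Rightarrow> bool" where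
  "viscosity_supersolution m u \<longleftrightarrow>
     continuous_on (UNIV \<times> {0<..}) u \<and>
     (\<forall>\<phi> p0 t0. t0 > 0 \<longrightarrow> C2_near \<phi> (p0, t0) \<longrightarrow>
        (\<forall>\<^sub>F z in nhds (p0, t0). u z - \<phi> z \<ge> u (p0, t0) - \<phi> (p0, t0)) \<longrightarrow>
        hj_operator m \<phi> p0 t0 \<ge> 0)"

definition viscosity_solution :: "(real \<Rightarrow> real) \<Rightarrow> (heis \<times> real \<Rightarrow> real) \<Rightarrow> bool" where
  "viscosity_solution m u \<longleftrightarrow> viscosity_subsolution m u \<and> viscosity_supersolution m u"

definition locally_uniformly_continuous :: "(real \<Rightarrow> real) \<Rightarrow> bool" where
  "locally_uniformly_continuous m \<longleftrightarrow> (\<forall>x. \<exists>e>0. uniformly_continuous_on (ball x e) m)"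

end

theory Submission
  imports Defs
begin

text \<open>The proof doubles the variables, using that \<open>d\<^sub>L\<close> is symmetric and left-invariant: although
  the horizontal gradients of \<open>d\<^sub>L(p, q)\<close> in \<open>p\<close> and in \<open>q\<close> are different vectors, they have the
  same norm, namely \<open>|(x, y)| / |h|\<^sub>G \<le> 1\<close> for \<open>h = p\<^sup>-\<^sup>1 q = (x, y, z)\<close>, and both the equality and
  the bound survive the regularisation \<open>(|h|\<^sub>G\<^sup>4 + e)\<^sup>1\<^sup>/\<^sup>4\<close> of the distance.
  If the Lipschitz bound fails at time \<open>\<tau>\<close>, one maximises
  \<open>u(p, t) - u(q, s) - L (d\<^sub>L(p, q)\<^sup>4 + e)\<^sup>1\<^sup>/\<^sup>4 - \<alpha> (|p|\<^sub>G\<^sup>4 + 1)\<^sup>1\<^sup>/\<^sup>4 - n (t - s)\<^sup>2 - \<eta> exp (k (t - \<tau>))\<close>.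
  At an interior maximum the two Hamiltonian terms are evaluated at numbers in \<open>[0, L + 1]\<close> that
  differ by at most \<open>\<alpha>\<close>, so for small \<open>\<alpha>\<close> their difference cannot compensate the strictly positive
  time derivative of the exponential penalty.\<close>

section \<open>Globally C2 functions and their closure properties\<close>

definition C2 :: "('a::real_normed_vector \<Rightarrow> real) \<Rightarrow> bool" where
  "C2 f \<longleftrightarrow>
     (\<exists>(f' :: 'a \<Rightarrow> 'a \<Rightarrow>\<^sub>L real) (f'' :: 'a \<Rightarrow> 'a \<Rightarrow>\<^sub>L 'a \<Rightarrow>\<^sub>L real).
        (\<forall>x. (f has_derivative blinfun_apply (f' x)) (at x)) \<and>
        (\<forall>x. (f' has_derivative blinfun_apply (f'' x)) (at x)) \<and>
        continuous_on UNIV f'')"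

text \<open>All test functions below are smooth on the whole space, so closure rules are proved for
  global smoothness and no neighbourhoods have to be intersected.\<close>

lemma C2_imp_C2_near: "C2 f \<Longrightarrow> C2_near f a"
  unfolding C2_def C2_near_def by (metis open_UNIV UNIV_I)

lemma C2_bounded_linear:
  assumes "bounded_linear f"
  shows "C2 f"
  unfolding C2_def
proof (intro exI conjI allI)
  fix x
  show "(f has_derivative blinfun_apply (Blinfun f)) (at x)"
    using assms by (simp add: bounded_linear_Blinfun_apply bounded_linear_imp_has_derivative)
  show "((\<lambda>x. Blinfun f) has_derivative blinfun_apply 0) (at x)"
    by (auto intro!: derivative_eq_intros)
qed auto

lemma C2_const: "C2 (\<lambda>x. c)"
  unfolding C2_def
proof (intro exI conjI allI)
  fix x
  show "((\<lambda>x. c) has_derivative blinfun_apply 0) (at x)"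
    by (auto intro!: derivative_eq_intros)
  show "((\<lambda>x. 0) has_derivative blinfun_apply 0) (at x)"
    by (auto intro!: derivative_eq_intros)
qed auto

lemma C2_add:
  assumes "C2 f" "C2 g"
  shows "C2 (\<lambda>x. f x + g x)"
proof -
  obtain f' f'' where f: "\<And>x. (f has_derivative blinfun_apply (f' x)) (at x)"
    "\<And>x. (f' has_derivative blinfun_apply (f'' x)) (at x)" "continuous_on UNIV f''"
    using assms(1) unfolding C2_def by blast
  obtain g' g'' where g: "\<And>x. (g has_derivative blinfun_apply (g' x)) (at x)"
    "\<And>x. (g' has_derivative blinfun_apply (g'' x)) (at x)" "continuous_on UNIV g''"
    using assms(2) unfolding C2_def by blast
  show ?thesis
    unfolding C2_def
  proof (intro exI conjI allI)
    fix x
    show "((\<lambda>x. f x + g x) has_derivative blinfun_apply (f' x + g' x)) (at x)"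
      using has_derivative_add[OF f(1) g(1)] by (simp add: plus_blinfun.rep_eq)
    show "((\<lambda>x. f' x + g' x) has_derivative blinfun_apply (f'' x + g'' x)) (at x)"
      using has_derivative_add[OF f(2) g(2)] by (simp add: plus_blinfun.rep_eq)
    show "continuous_on UNIV (\<lambda>x. f'' x + g'' x)"
      by (intro continuous_intros f g)
  qed
qed

text \<open>Chain rule: the second derivative is \<open>G' (f x)\<close> times \<open>f'' x\<close>
  plus the rank-one form sending \<open>(h, k)\<close> to
  \<open>G'' (f x) * f' x h * f' x k\<close>. The set \<open>V\<close> admits outer functions that
  are smooth only on part of the line, such as real powers on the positive half-line.\<close>

lemma C2_compose:
  fixes f :: "'a::real_normed_vector \<Rightarrow> real"
  assumes "C2 f" "\<And>x. f x \<in> V"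
    and G: "\<And>r. r \<in> V \<Longrightarrow> (G has_real_derivative G' r) (at r)"
    and G': "\<And>r. r \<in> V \<Longrightarrow> (G' has_real_derivative G'' r) (at r)"
    and G'': "continuous_on V G''"
  shows "C2 (\<lambda>x. G (f x))"
proof -
  obtain f' f'' where f: "\<And>x. (f has_derivative blinfun_apply (f' x)) (at x)"
    "\<And>x. (f' has_derivative blinfun_apply (f'' x)) (at x)" "continuous_on UNIV f''"
    using assms(1) unfolding C2_def by blast
  have cf: "continuous_on UNIV f" and cf': "continuous_on UNIV f'"
    using f(1,2) by (meson has_derivative_continuous continuous_at_imp_continuous_on)+
  have der: "((\<lambda>x. H (f x)) has_derivative (\<lambda>h. H' (f x) * f' x h)) (at x)"
    if "\<And>r. r \<in> V \<Longrightarrow> (H has_real_derivative H' r) (at r)" for x H H'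
    using diff_chain_at[OF f(1) that[OF assms(2), unfolded has_field_derivative_def]]
    by (simp add: o_def)
  show ?thesis
    unfolding C2_def
  proof (intro exI conjI allI)
    fix x
    show "((\<lambda>x. G (f x)) has_derivative blinfun_apply (G' (f x) *\<^sub>R f' x)) (at x)"
      using der[OF G] by (simp add: scaleR_blinfun.rep_eq)
    show "((\<lambda>x. G' (f x) *\<^sub>R f' x) has_derivative blinfun_apply
      (G' (f x) *\<^sub>R f'' x + (blinfun_scaleR_left (f' x) o\<^sub>L (G'' (f x) *\<^sub>R f' x)))) (at x)"
      by (rule has_derivative_eq_rhs[OF has_derivative_scaleR[OF der[OF G'] f(2)]])
        (auto simp: plus_blinfun.rep_eq scaleR_blinfun.rep_eq fun_eq_iff)
    have "continuous_on UNIV (\<lambda>x. G' (f x))"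
      using der[OF G'] by (meson has_derivative_continuous continuous_at_imp_continuous_on)
    moreover have "continuous_on UNIV (\<lambda>x. G'' (f x))"
      by (rule continuous_on_compose2[OF G'' cf]) (use assms(2) in auto)
    ultimately show "continuous_on UNIV (\<lambda>x. G' (f x) *\<^sub>R f'' x
        + (blinfun_scaleR_left (f' x) o\<^sub>L (G'' (f x) *\<^sub>R f' x)))"
      by (intro continuous_intros f cf' bounded_linear.continuous_on[OF bounded_linear_blinfun_scaleR_left])
  qed
qed

lemma C2_cmult: "C2 f \<Longrightarrow> C2 (\<lambda>x. c * f x)"
  by (rule C2_compose[where V=UNIV and G="\<lambda>r. c * r" and G'="\<lambda>_. c" and G''="\<lambda>_. 0"])
    (auto intro!: derivative_eq_intros)

lemma C2_power2: "C2 f \<Longrightarrow> C2 (\<lambda>x. (f x)\<^sup>2)"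
  by (rule C2_compose[where V=UNIV and G="\<lambda>r. r\<^sup>2" and G'="\<lambda>r. 2 * r" and G''="\<lambda>_. 2"])
    (auto intro!: derivative_eq_intros)

lemma C2_exp: "C2 f \<Longrightarrow> C2 (\<lambda>x. exp (f x))"
  by (rule C2_compose[where V=UNIV and G=exp and G'=exp and G''=exp])
    (auto intro!: derivative_eq_intros continuous_intros)

lemma C2_powr:
  assumes "C2 f" "\<And>x. f x > 0"
  shows "C2 (\<lambda>x. f x powr a)"
proof (rule C2_compose[where V="{0<..}" and G="\<lambda>r. r powr a"])
  fix r :: real assume r: "r \<in> {0<..}"
  show "((\<lambda>r. r powr a) has_real_derivative a * r powr (a - 1)) (at r)"
    using r by (intro has_real_derivative_powr) auto
  show "((\<lambda>r. a * r powr (a - 1)) has_real_derivative a * ((a - 1) * r powr (a - 1 - 1))) (at r)"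
    using r by (intro DERIV_cmult has_real_derivative_powr) auto
next
  show "continuous_on {0<..} (\<lambda>r. a * ((a - 1) * r powr (a - 1 - 1)))"
    by (intro continuous_intros) auto
qed (use assms in auto)

section \<open>The regularised gauge distance\<close>

fun gauge4 :: "heis \<Rightarrow> real" where
  "gauge4 (x, y, z) = (x\<^sup>2 + y\<^sup>2)\<^sup>2 + 16 * z\<^sup>2"

abbreviation ldiff :: "heis \<Rightarrow> heis \<Rightarrow> heis" where
  "ldiff p q \<equiv> heis_mult (heis_inv p) q"

lemma gauge4_nonneg: "gauge4 h \<ge> 0"
  by (cases h) simp

lemma dL_eq: "dL p q = root 4 (gauge4 (ldiff p q))"
  by (cases "ldiff p q") (simp add: dL_def)

text \<open>Swapping the points inverts \<open>ldiff p q\<close>, that is, negates its coordinates,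
  and \<open>gauge4\<close> is even.\<close>

lemma gauge4_ldiff_commute: "gauge4 (ldiff p q) = gauge4 (ldiff q p)"
  by (cases p; cases q) (simp add: power2_eq_square algebra_simps)

text \<open>Adding \<open>e > 0\<close> under the root removes the singularity of the distance on
  the diagonal. With \<open>e = 1\<close> and base point 0 the same function serves as the penalty
  at infinity.\<close>

definition smooth_dL :: "real \<Rightarrow> heis \<Rightarrow> heis \<Rightarrow> real" where
  "smooth_dL e p q = (gauge4 (ldiff p q) + e) powr (1/4)"

lemma smooth_dL_commute: "smooth_dL e p q = smooth_dL e q p"
  by (simp add: smooth_dL_def gauge4_ldiff_commute)

lemma dL_commute: "dL p q = dL q p"
  by (simp add: dL_eq gauge4_ldiff_commute)

lemma dL_le_smooth_dL: "e > 0 \<Longrightarrow> dL p q \<le> smooth_dL e p q"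
  using gauge4_nonneg[of "ldiff p q"]
  by (simp add: dL_eq smooth_dL_def flip: root_powr_inverse[of 4, simplified])

text \<open>The parameter is a fourth power so that the error is linear in \<open>d\<close>: for
  nonnegative \<open>a\<close> and \<open>d\<close>, \<open>a ^ 4 + d ^ 4\<close> is at most
  \<open>(a + d) ^ 4\<close>.\<close>

lemma smooth_dL_le:
  assumes "d > 0"
  shows "smooth_dL (d ^ 4) p q \<le> dL p q + d"
proof -
  have 0: "dL p q \<ge> 0" "dL p q ^ 4 = gauge4 (ldiff p q)"
    using gauge4_nonneg[of "ldiff p q"] by (simp_all add: dL_eq)
  have "dL p q ^ 4 + d ^ 4 \<le> (dL p q + d) ^ 4"
    using 0(1) assms by (simp add: power4_eq_xxxx algebra_simps)
  moreover have "smooth_dL (d ^ 4) p q = root 4 (dL p q ^ 4 + d ^ 4)"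
    using 0 assms gauge4_nonneg[of "ldiff p q"]
    by (simp add: smooth_dL_def root_powr_inverse add_nonneg_pos)
  ultimately have "smooth_dL (d ^ 4) p q \<le> root 4 ((dL p q + d) ^ 4)"
    by simp
  also have "\<dots> = dL p q + d"
    using 0(1) assms by (intro real_root_power_cancel) auto
  finally show ?thesis .
qed

lemma smooth_dL_pow4: "e > 0 \<Longrightarrow> smooth_dL e p q ^ 4 = gauge4 (ldiff p q) + e"
  using gauge4_nonneg[of "ldiff p q"]
  by (simp add: smooth_dL_def powr_power add_nonneg_pos)

lemma smooth_dL_nonneg: "smooth_dL e p q \<ge> 0"
  by (simp add: smooth_dL_def)

lemma C2_smooth_dL:
  assumes "e > 0"
  shows "C2 (\<lambda>z::heis \<times> real. smooth_dL e a (fst z))"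
proof -
  obtain a1 a2 a3 where a: "a = (a1, a2, a3)" by (cases a)
  \<comment> \<open>In coordinates, with subtraction written as adding a negative, the function
    matches the closure rules for \<open>C2\<close>.\<close>
  have eq: "(\<lambda>z::heis \<times> real. smooth_dL e a (fst z)) = (\<lambda>z.
     ((((fst (fst z) + - a1)\<^sup>2 + (fst (snd (fst z)) + - a2)\<^sup>2)\<^sup>2
      + 16 * ((snd (snd (fst z)) + - a3) + (1/2) * ((- a1) * fst (snd (fst z)) + a2 * fst (fst z)))\<^sup>2) + e) powr (1/4))"
    by (auto simp: fun_eq_iff smooth_dL_def a algebra_simps)
  show ?thesis
    unfolding eq
    by (intro C2_powr C2_add C2_cmult C2_power2 C2_const C2_bounded_linear add_nonneg_pos assms)
      (auto intro!: bounded_linear_intros)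
qed

section \<open>Horizontal gradients of the regularised distance\<close>

lemma horizontal_gradient_eqI:
  assumes "(f has_derivative f') (at (x, y, z))"
  shows "horizontal_gradient f (x, y, z) = (f' (1, 0, - y / 2), f' (0, 1, x / 2))"
proof -
  interpret f': bounded_linear f' using assms by (rule has_derivative_bounded_linear)
  have d: "deriv (\<lambda>s. f (c s)) s0 = f' v"
    if "(c has_vector_derivative v) (at s0)" "c s0 = (x, y, z)" for c v s0
  proof (rule DERIV_imp_deriv)
    have "((\<lambda>s. f (c s)) has_derivative (\<lambda>s. f' (s *\<^sub>R v))) (at s0)"
      using diff_chain_at[OF that(1)[unfolded has_vector_derivative_def], of f f'] assms that(2)
      by (simp add: o_def)
    then show "((\<lambda>s. f (c s)) has_real_derivative f' v) (at s0)"
      by (simp add: has_field_derivative_def f'.scaleR mult_commute_abs)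
  qed
  have "deriv (\<lambda>s. f (s, y, z)) x = f' (1, 0, 0)"
    by (rule d) (auto intro!: derivative_eq_intros has_vector_derivative_Pair simp: zero_prod_def)
  moreover have "deriv (\<lambda>s. f (x, s, z)) y = f' (0, 1, 0)"
    by (rule d) (auto intro!: derivative_eq_intros has_vector_derivative_Pair simp: zero_prod_def)
  moreover have "deriv (\<lambda>s. f (x, y, s)) z = f' (0, 0, 1)"
    by (rule d) (auto intro!: derivative_eq_intros has_vector_derivative_Pair simp: zero_prod_def)
  moreover have "f' (1, 0, - y / 2) = f' (1, 0, 0) - (y / 2) * f' (0, 0, 1)"
    using f'.diff[of "(1,0,0)" "(y/2) *\<^sub>R (0,0,1)"] f'.scaleR[of "y/2" "(0,0,1)"] by simp
  moreover have "f' (0, 1, x / 2) = f' (0, 1, 0) + (x / 2) * f' (0, 0, 1)"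
    using f'.add[of "(0,1,0)" "(x/2) *\<^sub>R (0,0,1)"] f'.scaleR[of "x/2" "(0,0,1)"] by simp
  ultimately show ?thesis
    by (simp add: horizontal_gradient_def)
qed

fun quarter_hgrad_gauge4 :: "heis \<Rightarrow> real \<times> real" where
  "quarter_hgrad_gauge4 (x, y, z) = ((x\<^sup>2 + y\<^sup>2) * x - 4 * y * z, (x\<^sup>2 + y\<^sup>2) * y + 4 * x * z)"

text \<open>The 1/4 from differentiating the power cancels the factor 4 in the gradient of
  \<open>gauge4\<close>. By left invariance only \<open>ldiff a p\<close> enters.\<close>

definition hgrad_smooth_dL :: "real \<Rightarrow> heis \<Rightarrow> heis \<Rightarrow> real \<times> real" where
  "hgrad_smooth_dL e a p = (gauge4 (ldiff a p) + e) powr (- 3/4) *\<^sub>R quarter_hgrad_gauge4 (ldiff a p)"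

lemma smooth_dL_has_derivative:
  assumes "e > 0"
  obtains f' where "(smooth_dL e a has_derivative f') (at (x, y, z))"
    "(f' (1, 0, - y / 2), f' (0, 1, x / 2)) = hgrad_smooth_dL e a (x, y, z)"
proof -
  obtain a1 a2 a3 where a: "a = (a1, a2, a3)" by (cases a)
  define h1 h2 h3 where "h1 = x - a1" and "h2 = y - a2" and "h3 = z - a3 + (1/2) * (a2 * x - a1 * y)"
  have h: "ldiff a (x, y, z) = (h1, h2, h3)"
    by (simp add: a h1_def h2_def h3_def algebra_simps)
  define g' :: "heis \<Rightarrow> real" where "g' = (\<lambda>(v1, v2, v3). 4 * (h1\<^sup>2 + h2\<^sup>2) * (h1 * v1 + h2 * v2)
    + 32 * h3 * (v3 + (1/2) * (a2 * v1 - a1 * v2)))"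
  define w where "w = gauge4 (ldiff a (x, y, z)) + e"
  have w: "w > 0" using assms gauge4_nonneg unfolding w_def by (simp add: add_nonneg_pos)
  have eq: "(\<lambda>p. gauge4 (ldiff a p) + e) = (\<lambda>p. ((fst p - a1)\<^sup>2 + (fst (snd p) - a2)\<^sup>2)\<^sup>2
      + 16 * ((snd (snd p) - a3) + (1/2) * (a2 * fst p - a1 * fst (snd p)))\<^sup>2 + e)"
    by (auto simp: fun_eq_iff a algebra_simps)
  have "((\<lambda>p. gauge4 (ldiff a p) + e) has_derivative g') (at (x, y, z))"
    unfolding eq
    by (auto intro!: derivative_eq_intros simp: fun_eq_iff g'_def h1_def h2_def h3_def)
      (simp add: field_simps power2_eq_square)
  then have "((\<lambda>p. (gauge4 (ldiff a p) + e) powr (1/4)) has_derivative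
      (\<lambda>v. g' v * ((1/4) * w powr (1/4 - 1)))) (at (x, y, z))"
    by (intro DERIV_compose_FDERIV[where f = "\<lambda>r. r powr (1/4)"])
      (use w in \<open>auto simp: w_def intro!: has_real_derivative_powr[where r="1/4", simplified]\<close>)
  moreover have "smooth_dL e a = (\<lambda>p. (gauge4 (ldiff a p) + e) powr (1/4))"
    by (simp add: fun_eq_iff smooth_dL_def)
  moreover have "(g' (1, 0, - y / 2) * ((1/4) * w powr (1/4 - 1)), g' (0, 1, x / 2) * ((1/4) * w powr (1/4 - 1)))
      = hgrad_smooth_dL e a (x, y, z)"
  proof -
    \<comment> \<open>In these variables the coordinates of \<open>a\<close> cancel in the
      derivatives along the two horizontal directions, which is left invariance by direct
      computation.\<close>
    have xy: "x = h1 + a1" "y = h2 + a2"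
      by (simp_all add: h1_def h2_def)
    have "(g' (1, 0, - y / 2), g' (0, 1, x / 2)) = 4 *\<^sub>R quarter_hgrad_gauge4 (h1, h2, h3)"
      unfolding g'_def xy by (simp add: field_simps)
    moreover have "hgrad_smooth_dL e a (x, y, z) = w powr (1/4 - 1) *\<^sub>R quarter_hgrad_gauge4 (h1, h2, h3)"
      unfolding hgrad_smooth_dL_def w_def h by simp
    ultimately show ?thesis
      by (simp add: prod_eq_iff)
  qed
  ultimately show thesis
    using that by metis
qed

text \<open>The mixed terms of the two squares cancel, and a factor
  \<open>x\<^sup>2 + y\<^sup>2\<close> splits off.\<close>

lemma norm_quarter_hgrad_gauge4: "norm (quarter_hgrad_gauge4 (x, y, z)) = sqrt ((x\<^sup>2 + y\<^sup>2) * gauge4 (x, y, z))"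
proof -
  have "((x\<^sup>2 + y\<^sup>2) * x - 4 * y * z)\<^sup>2 + ((x\<^sup>2 + y\<^sup>2) * y + 4 * x * z)\<^sup>2
    = (x\<^sup>2 + y\<^sup>2) * ((x\<^sup>2 + y\<^sup>2)\<^sup>2 + 16 * z\<^sup>2)"
    by algebra
  then show ?thesis
    by (simp add: norm_Pair)
qed

text \<open>Swapping the points negates \<open>ldiff p q\<close>. The gradient need not merely
  change sign, but its norm depends only on \<open>x\<^sup>2 + y\<^sup>2\<close> and
  \<open>gauge4\<close>, both even.\<close>

lemma norm_hgrad_smooth_dL_commute: "norm (hgrad_smooth_dL e p q) = norm (hgrad_smooth_dL e q p)"
proof -
  obtain x y z where h: "ldiff p q = (x, y, z)" by (cases "ldiff p q")
  then have h': "ldiff q p = (- x, - y, - z)"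
    by (cases p; cases q) (auto simp: field_simps)
  show ?thesis
    by (simp add: hgrad_smooth_dL_def h h' norm_quarter_hgrad_gauge4 del: quarter_hgrad_gauge4.simps)
qed

text \<open>Since \<open>x\<^sup>2 + y\<^sup>2\<close> is at most \<open>sqrt w\<close>, the
  unscaled gradient has norm at most \<open>w powr (3/4)\<close>, which the prefactor
  \<open>w powr (- 3/4)\<close> cancels.\<close>

lemma norm_hgrad_smooth_dL_le:
  assumes "e > 0"
  shows "norm (hgrad_smooth_dL e p q) \<le> 1"
proof -
  obtain x y z where h: "ldiff p q = (x, y, z)" by (cases "ldiff p q")
  define w where "w = gauge4 (x, y, z) + e"
  have w: "w > 0" "gauge4 (x, y, z) \<le> w"
    using assms gauge4_nonneg[of "(x, y, z)"] unfolding w_def by linarith+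
  have "x\<^sup>2 + y\<^sup>2 \<le> sqrt w"
    using w by (intro real_le_rsqrt) (auto simp: w_def)
  then have "(x\<^sup>2 + y\<^sup>2) * gauge4 (x, y, z) \<le> w powr (1/2) * w"
    using w gauge4_nonneg[of "(x, y, z)"] by (intro mult_mono) (auto simp: powr_half_sqrt)
  also have "\<dots> = w powr (3/2)"
    using w powr_add[of w "1/2" 1] by simp
  finally have "norm (quarter_hgrad_gauge4 (x, y, z)) \<le> (w powr (3/2)) powr (1/2)"
    unfolding norm_quarter_hgrad_gauge4 by (simp add: powr_half_sqrt)
  then have "norm (quarter_hgrad_gauge4 (x, y, z)) \<le> w powr (3/4)"
    by (simp add: powr_powr)
  then have "norm (hgrad_smooth_dL e p q) \<le> w powr (- 3/4) * w powr (3/4)"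
    by (simp add: hgrad_smooth_dL_def h w_def[symmetric] mult_left_mono del: quarter_hgrad_gauge4.simps gauge4.simps)
  also have "\<dots> = 1"
    using w by (simp flip: powr_add)
  finally show ?thesis .
qed

text \<open>One form covers both test functions of the doubling argument: \<open>l = L\<close> with
  the penalty at infinity, and \<open>l = - L\<close> with \<open>\<alpha> = 0\<close>.\<close>

lemma hj_operator_smooth_dL:
  assumes "e > 0" "(\<tau> has_real_derivative \<tau>') (at t)"
  shows "hj_operator m (\<lambda>z. l * smooth_dL e a (fst z) + \<alpha> * smooth_dL 1 b (fst z) + \<tau> (snd z)) p t
    = \<tau>' + m (norm (l *\<^sub>R hgrad_smooth_dL e a p + \<alpha> *\<^sub>R hgrad_smooth_dL 1 b p))"
proof -
  obtain x y z where p: "p = (x, y, z)" by (cases p)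
  obtain f' where f: "(smooth_dL e a has_derivative f') (at (x, y, z))"
    "hgrad_smooth_dL e a (x, y, z) = (f' (1, 0, - y / 2), f' (0, 1, x / 2))"
    using smooth_dL_has_derivative[OF assms(1)] by metis
  obtain g' where g: "(smooth_dL 1 b has_derivative g') (at (x, y, z))"
    "hgrad_smooth_dL 1 b (x, y, z) = (g' (1, 0, - y / 2), g' (0, 1, x / 2))"
    using smooth_dL_has_derivative[of 1] by (metis zero_less_one)
  have "((\<lambda>q. l * smooth_dL e a q + \<alpha> * smooth_dL 1 b q + \<tau> t) has_derivative (\<lambda>v. l * f' v + \<alpha> * g' v)) (at (x, y, z))"
    by (auto intro!: derivative_eq_intros f g)
  from horizontal_gradient_eqI[OF this]
  have "horizontal_gradient (\<lambda>q. l * smooth_dL e a q + \<alpha> * smooth_dL 1 b q + \<tau> t) p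
     = l *\<^sub>R hgrad_smooth_dL e a p + \<alpha> *\<^sub>R hgrad_smooth_dL 1 b p"
    by (simp add: p f(2) g(2))
  moreover have "deriv (\<lambda>s. l * smooth_dL e a p + \<alpha> * smooth_dL 1 b p + \<tau> s) t = \<tau>'"
    by (rule DERIV_imp_deriv) (auto intro!: derivative_eq_intros assms)
  ultimately show ?thesis
    by (simp add: hj_operator_def)
qed


section \<open>Continuity, compactness and existence of maxima\<close>

lemma continuous_on_smooth_dL [continuous_intros]:
  assumes "continuous_on S f" "continuous_on S g" "e > 0"
  shows "continuous_on S (\<lambda>x. smooth_dL e (f x) (g x))"
proof -
  have eq: "gauge4 (ldiff p q) = ((fst q - fst p)\<^sup>2 + (fst (snd q) - fst (snd p))\<^sup>2)\<^sup>2
      + 16 * (snd (snd q) - snd (snd p) + (1/2) * (fst q * fst (snd p) - fst p * fst (snd q)))\<^sup>2" for p q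
    by (cases p; cases q) (simp add: algebra_simps)
  have "continuous_on S (\<lambda>x. gauge4 (ldiff (f x) (g x)))"
    unfolding eq by (intro continuous_intros assms)
  moreover have "gauge4 (ldiff (f x) (g x)) + e \<noteq> 0" for x
    using gauge4_nonneg[of "ldiff (f x) (g x)"] assms(3) by linarith
  ultimately show ?thesis
    unfolding smooth_dL_def by (intro continuous_intros) auto
qed

lemma compact_gauge4_le: "compact {h. gauge4 h \<le> C}"
proof (subst compact_eq_bounded_closed, intro conjI)
  have eq: "gauge4 = (\<lambda>h. ((fst h)\<^sup>2 + (fst (snd h))\<^sup>2)\<^sup>2 + 16 * (snd (snd h))\<^sup>2)"
    by (auto simp: fun_eq_iff)
  show "closed {h. gauge4 h \<le> C}"
    unfolding eq by (intro closed_Collect_le continuous_intros)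
  \<comment> \<open>Used for each coordinate and once more for \<open>x\<^sup>2 + y\<^sup>2\<close>,
    this costs 1 four times, whence the bound \<open>4 + C\<close>.\<close>
  have le: "\<bar>r\<bar> \<le> 1 + r\<^sup>2" for r :: real
    using zero_le_power2[of "\<bar>r\<bar> - 1"] by (simp add: power2_eq_square algebra_simps)
  show "bounded {h. gauge4 h \<le> C}"
  proof (rule boundedI)
    fix h assume "h \<in> {h. gauge4 h \<le> C}"
    moreover obtain x y z where h: "h = (x, y, z)" by (cases h)
    ultimately have C: "(x\<^sup>2 + y\<^sup>2)\<^sup>2 + 16 * z\<^sup>2 \<le> C" by simp
    have "norm h \<le> \<bar>x\<bar> + (\<bar>y\<bar> + \<bar>z\<bar>)"
      unfolding h using norm_Pair_le[of x "(y, z)"] norm_Pair_le[of y z] by simp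
    moreover have "x\<^sup>2 + y\<^sup>2 \<le> 1 + (x\<^sup>2 + y\<^sup>2)\<^sup>2"
      using le[of "x\<^sup>2 + y\<^sup>2"] by linarith
    moreover have "0 \<le> z\<^sup>2" by simp
    ultimately show "norm h \<le> 4 + C"
      using le[of x] le[of y] le[of z] C by linarith
  qed
qed

lemma compact_smooth_dL_le:
  assumes "e > 0"
  shows "compact {(p, q). smooth_dL 1 0 p \<le> A \<and> smooth_dL e p q \<le> B}"
proof (subst compact_eq_bounded_closed, intro conjI)
  let ?S = "{(p, q). smooth_dL 1 0 p \<le> A \<and> smooth_dL e p q \<le> B}"
  have "?S = {w. smooth_dL 1 0 (fst w) \<le> A} \<inter> {w. smooth_dL e (fst w) (snd w) \<le> B}" by auto
  moreover have "closed \<dots>"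
    using assms by (intro closed_Int closed_Collect_le continuous_intros) auto
  ultimately show "closed ?S" by simp
  define K where "K = {h. gauge4 h \<le> A ^ 4} \<times> {h. gauge4 h \<le> B ^ 4}"
  \<comment> \<open>This is the map from \<open>(p, h)\<close> to \<open>(p, heis_mult p h)\<close>
    in coordinates; it recovers \<open>(p, q)\<close> from \<open>p\<close> and
    \<open>ldiff p q\<close>, both of which range over compact sets.\<close>
  define f where "f = (\<lambda>w::heis \<times> heis. (fst w, (fst (fst w) + fst (snd w),
     fst (snd (fst w)) + fst (snd (snd w)), snd (snd (fst w)) + snd (snd (snd w))
     + (1/2) * (fst (fst w) * fst (snd (snd w)) - fst (snd w) * fst (snd (fst w))))))"
  have "compact (f ` K)"
    unfolding f_def K_def
    by (intro compact_continuous_image compact_Times compact_gauge4_le continuous_intros)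
  moreover have "?S \<subseteq> f ` K"
  proof clarify
    fix p q assume *: "smooth_dL 1 0 p \<le> A" "smooth_dL e p q \<le> B"
    have 0: "ldiff 0 p = p" by (cases p) (simp add: zero_prod_def)
    have "gauge4 p + 1 \<le> A ^ 4"
      using power_mono[OF *(1) smooth_dL_nonneg, of 4] smooth_dL_pow4[of 1 0 p] by (simp add: 0)
    moreover have "gauge4 (ldiff p q) + e \<le> B ^ 4"
      using power_mono[OF *(2) smooth_dL_nonneg, of 4] smooth_dL_pow4[OF assms, of p q] by simp
    ultimately have "(p, ldiff p q) \<in> K"
      using assms by (simp add: K_def)
    moreover have "f (p, ldiff p q) = (p, q)"
      by (cases p; cases q) (simp add: f_def field_simps)
    ultimately show "(p, q) \<in> f ` K"
      by (metis image_eqI)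
  qed
  ultimately show "bounded ?S"
    using compact_imp_bounded bounded_subset by blast
qed

text \<open>Points of \<open>S\<close> outside \<open>K\<close> have values below that of
  \<open>z1\<close>, so a maximum over the compact set \<open>S \<inter> K\<close> is a maximum over
  \<open>S\<close>.\<close>

lemma attains_sup_superlevel:
  fixes \<Phi> :: "'a::metric_space \<Rightarrow> real"
  assumes "closed S" "continuous_on S \<Phi>" "z1 \<in> S" "compact K"
    and "\<And>z. z \<in> S \<Longrightarrow> \<Phi> z1 \<le> \<Phi> z \<Longrightarrow> z \<in> K"
  obtains z0 where "z0 \<in> S" "\<And>z. z \<in> S \<Longrightarrow> \<Phi> z \<le> \<Phi> z0"
proof -
  have "compact (S \<inter> K)" using assms by (intro closed_Int_compact)
  moreover have z1: "z1 \<in> S \<inter> K" using assms by auto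
  moreover have "continuous_on (S \<inter> K) \<Phi>" using assms(2) continuous_on_subset by blast
  ultimately obtain z0 where z0: "z0 \<in> S \<inter> K" "\<And>z. z \<in> S \<inter> K \<Longrightarrow> \<Phi> z \<le> \<Phi> z0"
    using continuous_attains_sup by (metis empty_iff)
  have "\<Phi> z \<le> \<Phi> z0" if "z \<in> S" for z
    using z0(2)[of z] z0(2)[OF z1] assms(5)[OF that] that by (cases "\<Phi> z1 \<le> \<Phi> z") auto
  then show thesis using that z0(1) by blast
qed

lemma eventually_nhds_snd_in:
  assumes "t0 \<in> T" "open T" "\<And>p t. t \<in> T \<Longrightarrow> P (p, t)"
  shows "\<forall>\<^sub>F z in nhds (p0, t0). P z"
  unfolding eventually_nhds
  by (rule exI[of _ "UNIV \<times> T"]) (use assms in \<open>auto intro!: open_Times\<close>)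

section \<open>The doubling of variables\<close>

lemma viscosity_solution_difference_le:
  assumes m: "continuous_on UNIV m"
    and u: "continuous_on (UNIV \<times> {0..}) u"
    and sub: "viscosity_subsolution m u" and super: "viscosity_supersolution m u"
    and bdd: "\<And>T. T > 0 \<Longrightarrow> bounded (u ` (UNIV \<times> {0..<T}))"
    and L: "L > 0"
    and init: "\<And>p q. u (p, 0) - u (q, 0) \<le> L * dL p q"
    and \<tau>: "\<tau> > 0"
  shows "u (p1, \<tau>) - u (q1, \<tau>) \<le> L * dL p1 q1"
proof (rule ccontr)
  \<comment> \<open>The penalties will give \<open>t < \<tau> + 1\<close> and
    \<open>\<bar>t - s\<bar> < 1\<close>, so both times stay strictly below
    \<open>T\<close>.\<close>
  define T where "T = \<tau> + 2"
  define \<theta> where "\<theta> = u (p1, \<tau>) - u (q1, \<tau>) - L * dL p1 q1"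
  assume "\<not> u (p1, \<tau>) - u (q1, \<tau>) \<le> L * dL p1 q1"
  then have \<theta>: "\<theta> > 0" by (simp add: \<theta>_def)
  obtain M where M: "M > 0" "\<And>p t. t \<in> {0..T} \<Longrightarrow> \<bar>u (p, t)\<bar> \<le> M"
  proof -
    have "bounded (u ` (UNIV \<times> {0..<T + 1}))" using bdd \<tau> by (simp add: T_def)
    then obtain M where "M > 0" "\<forall>y \<in> u ` (UNIV \<times> {0..<T + 1}). norm y \<le> M"
      using bounded_pos by blast
    then show thesis using that[of M] by force
  qed
  txt \<open>The regularisation, the penalty in \<open>p\<close> and the penalty in time each cost at most \<open>\<theta> / 4\<close> at
    the point \<open>(p1, q1, \<tau>, \<tau>)\<close>, which leaves a maximum of at least \<open>\<theta> / 4\<close>; \<open>k\<close> is so large that the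
    time penalty forces \<open>t < \<tau> + 1\<close>.\<close>
  define \<delta> where "\<delta> = \<theta> / (4 * L)"
  define e where "e = \<delta> ^ 4"
  define \<eta> where "\<eta> = \<theta> / 4"
  define k where "k = 2 * M / \<eta>"
  \<comment> \<open>The derivative of the exponential penalty at time 0, hence a lower bound for it
    at all later times.\<close>
  define \<sigma> where "\<sigma> = \<eta> * k * exp (- (k * \<tau>))"
  have pos: "\<delta> > 0" "e > 0" "\<eta> > 0" "k > 0" "\<sigma> > 0"
    using \<theta> L M(1) by (simp_all add: \<delta>_def e_def \<eta>_def k_def \<sigma>_def)
  have "2 * M < \<eta> * (1 + k)"
    using pos by (simp add: k_def field_simps)
  also have "\<dots> \<le> \<eta> * exp k"
    using pos by (intro mult_left_mono) auto
  finally have \<eta>k: "2 * M < \<eta> * exp k" .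

  have "uniformly_continuous_on {0..L + 1} m"
    using m by (intro compact_uniformly_continuous) (auto intro: continuous_on_subset)
  then obtain \<rho> where \<rho>: "\<rho> > 0"
    "\<And>x y. x \<in> {0..L + 1} \<Longrightarrow> y \<in> {0..L + 1} \<Longrightarrow> \<bar>x - y\<bar> < \<rho> \<Longrightarrow> \<bar>m x - m y\<bar> < \<sigma>"
    unfolding uniformly_continuous_on_def dist_real_def using pos(5) by metis
  \<comment> \<open>The first bound serves the modulus of continuity of \<open>m\<close>, the second
    keeps the perturbed gradient norm within \<open>L + 1\<close>, the third limits the cost at
    \<open>p1\<close>.\<close>
  define \<alpha> where "\<alpha> = min (\<rho> / 2) (min 1 (\<theta> / (4 * (smooth_dL 1 0 p1 + 1))))"
  have \<alpha>: "\<alpha> > 0" "\<alpha> < \<rho>" "\<alpha> \<le> 1"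
    using \<rho>(1) \<theta> smooth_dL_nonneg[of 1 0 p1] by (auto simp: \<alpha>_def)
  have "\<alpha> * smooth_dL 1 0 p1 \<le> \<theta> / (4 * (smooth_dL 1 0 p1 + 1)) * (smooth_dL 1 0 p1 + 1)"
    using smooth_dL_nonneg[of 1 0 p1] \<theta> by (intro mult_mono) (auto simp: \<alpha>_def)
  also have "\<dots> = \<theta> / 4"
    using smooth_dL_nonneg[of 1 0 p1] by (simp add: field_simps)
  finally have \<alpha>p1: "\<alpha> * smooth_dL 1 0 p1 \<le> \<theta> / 4" .

  txt \<open>Penalising \<open>p\<close> alone suffices for compactness, since \<open>u\<close> is bounded and the distance term
    keeps \<open>q\<close> near \<open>p\<close>.\<close>
  define K where "K = {(p, q). smooth_dL 1 0 p \<le> 2 * M / \<alpha> \<and> smooth_dL e p q \<le> 2 * M / L}"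
  have K: "compact (K \<times> ({0..T} \<times> {0..T}))"
    unfolding K_def using pos by (intro compact_Times compact_smooth_dL_le) auto
  define W where "W = (\<lambda>z::(heis \<times> heis) \<times> (real \<times> real).
    u (fst (fst z), fst (snd z)) - u (snd (fst z), snd (snd z)))"
  define S where "S = (UNIV :: (heis \<times> heis) set) \<times> ({0..T} \<times> {0..T})"
  have W: "continuous_on S W"
    unfolding W_def S_def
    by (intro continuous_intros continuous_on_compose2[OF u]) auto
  then have "uniformly_continuous_on (K \<times> ({0..T} \<times> {0..T})) W"
    using K by (intro compact_uniformly_continuous) (auto simp: S_def intro: continuous_on_subset)
  then obtain d where d: "d > 0"
    "\<And>z z'. z \<in> K \<times> ({0..T} \<times> {0..T}) \<Longrightarrow> z' \<in> K \<times> ({0..T} \<times> {0..T}) \<Longrightarrow> dist z' z < d \<Longrightarrow> \<bar>W z' - W z\<bar> < \<theta> / 4"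
    unfolding uniformly_continuous_on_def dist_real_def[symmetric] using \<theta>
    by (metis zero_less_divide_iff zero_less_numeral)
  \<comment> \<open>The set \<open>K\<close> does not involve \<open>n\<close>, so the modulus
    \<open>d\<close> of \<open>W\<close> is fixed first and \<open>n\<close> can then be chosen to
    force \<open>\<bar>t - s\<bar> < d'\<close>.\<close>
  define d' where "d' = min d 1"
  have d': "d' > 0" "d' \<le> d" "d' \<le> 1" using d(1) by (auto simp: d'_def)
  define n where "n = 2 * M / d'\<^sup>2"
  have n: "n > 0" using M(1) d' by (simp add: n_def)

  define \<Phi> where "\<Phi> = (\<lambda>z. W z - L * smooth_dL e (fst (fst z)) (snd (fst z)) - \<alpha> * smooth_dL 1 0 (fst (fst z))
     - n * (fst (snd z) - snd (snd z))\<^sup>2 - \<eta> * exp (k * (fst (snd z) - \<tau>)))"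
  have \<Phi>_eq: "\<Phi> ((p, q), (t, s)) = u (p, t) - u (q, s) - L * smooth_dL e p q - \<alpha> * smooth_dL 1 0 p
     - n * (t - s)\<^sup>2 - \<eta> * exp (k * (t - \<tau>))" for p q t s
    by (simp add: \<Phi>_def W_def)
  define z1 where "z1 = ((p1, q1), (\<tau>, \<tau>))"
  have z1: "z1 \<in> S" using \<tau> by (simp add: z1_def S_def T_def)
  have "L * smooth_dL e p1 q1 \<le> L * (dL p1 q1 + \<delta>)"
    unfolding e_def using L smooth_dL_le[OF pos(1)] by (intro mult_left_mono) auto
  also have "\<dots> = L * dL p1 q1 + \<theta> / 4"
    using L by (simp add: \<delta>_def field_simps)
  finally have smooth_le: "L * smooth_dL e p1 q1 \<le> L * dL p1 q1 + \<theta> / 4" .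
  have \<Phi>z1: "\<Phi> z1 \<ge> \<theta> / 4"
  proof -
    have "\<Phi> z1 = u (p1, \<tau>) - u (q1, \<tau>) - L * smooth_dL e p1 q1 - \<alpha> * smooth_dL 1 0 p1 - \<eta>"
      by (simp add: z1_def \<Phi>_eq)
    then show ?thesis
      using smooth_le \<alpha>p1 \<theta>_def \<eta>_def by linarith
  qed

  \<comment> \<open>Here \<Phi> is positive and the difference of the values of \<open>u\<close> is
    at most \<open>2 * M\<close>, so each single penalty term is at most
    \<open>2 * M\<close>.\<close>
  have penalty: "smooth_dL e p q \<le> 2 * M / L" "smooth_dL 1 0 p \<le> 2 * M / \<alpha>" "\<bar>t - s\<bar> < d'" "t < \<tau> + 1"
    if "((p, q), (t, s)) \<in> S" "\<Phi> z1 \<le> \<Phi> ((p, q), (t, s))" for p q t s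
  proof -
    have ts: "t \<in> {0..T}" "s \<in> {0..T}" using that(1) by (auto simp: S_def)
    have "u (p, t) - u (q, s) \<le> 2 * M"
      using M(2)[OF ts(1), of p] M(2)[OF ts(2), of q] by linarith
    moreover have "L * smooth_dL e p q \<ge> 0" "\<alpha> * smooth_dL 1 0 p \<ge> 0" "n * (t - s)\<^sup>2 \<ge> 0" "\<eta> * exp (k * (t - \<tau>)) > 0"
      using L \<alpha> n pos smooth_dL_nonneg by auto
    ultimately have *: "L * smooth_dL e p q \<le> 2 * M" "\<alpha> * smooth_dL 1 0 p \<le> 2 * M" "n * (t - s)\<^sup>2 < 2 * M"
        "\<eta> * exp (k * (t - \<tau>)) < 2 * M"
      using that(2) \<Phi>z1 \<theta> unfolding \<Phi>_eq by linarith+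
    show "smooth_dL e p q \<le> 2 * M / L" "smooth_dL 1 0 p \<le> 2 * M / \<alpha>"
      using *(1,2) L \<alpha> by (simp_all add: field_simps)
    have "(t - s)\<^sup>2 < d'\<^sup>2"
      using *(3) M(1) d' by (simp add: n_def field_simps)
    then show "\<bar>t - s\<bar> < d'"
      using d' by (intro power2_less_imp_less[of "\<bar>t - s\<bar>" d']) auto
    have "\<eta> * exp (k * (t - \<tau>)) < \<eta> * exp k" using *(4) \<eta>k by linarith
    then have "k * (t - \<tau>) < k * 1" using pos by simp
    then show "t < \<tau> + 1" using pos by (simp only: mult_less_cancel_left_pos)
  qed

  have "continuous_on S \<Phi>"
    unfolding \<Phi>_def using pos by (intro continuous_intros W) auto
  moreover have "closed S" unfolding S_def by (intro closed_Times) auto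
  moreover have "z \<in> K \<times> ({0..T} \<times> {0..T})" if "z \<in> S" "\<Phi> z1 \<le> \<Phi> z" for z
    using that penalty by (cases z) (auto simp: K_def S_def)
  ultimately obtain z0 where z0: "z0 \<in> S" "\<And>z. z \<in> S \<Longrightarrow> \<Phi> z \<le> \<Phi> z0"
    using attains_sup_superlevel[of S \<Phi> z1] z1 K by metis
  obtain p0 q0 t0 s0 where z0_eq: "z0 = ((p0, q0), (t0, s0))" by (metis surj_pair)
  have ts: "0 \<le> t0" "t0 \<le> T" "0 \<le> s0" "s0 \<le> T" using z0(1) by (auto simp: z0_eq S_def)
  note pen = penalty[OF z0(1)[unfolded z0_eq] z0(2)[OF z1, unfolded z0_eq]]
  have lt: "t0 < T" "s0 < T" using pen(3,4) d' by (auto simp: T_def)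

  \<comment> \<open>If one time is 0, moving both to 0 changes \<open>W\<close> by less than
    \<open>\<theta> / 4\<close>; the initial Lipschitz bound then pushes the maximum below
    \<open>\<theta> / 4\<close>.\<close>
  have "t0 \<noteq> 0 \<and> s0 \<noteq> 0"
  proof (rule ccontr)
    assume "\<not> (t0 \<noteq> 0 \<and> s0 \<noteq> 0)"
    then have "dist z0 ((p0, q0), (0, 0)) = \<bar>t0 - s0\<bar>"
      by (auto simp: z0_eq dist_Pair_Pair dist_real_def)
    then have "dist z0 ((p0, q0), (0, 0)) < d" using pen(3) d' by linarith
    moreover have "z0 \<in> K \<times> ({0..T} \<times> {0..T})" "((p0, q0), (0, 0)) \<in> K \<times> ({0..T} \<times> {0..T})"
      using ts pen(1,2) by (auto simp: z0_eq K_def)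
    ultimately have "\<bar>W z0 - W ((p0, q0), (0, 0))\<bar> < \<theta> / 4"
      using d(2) by blast
    moreover have "W ((p0, q0), (0, 0)) = u (p0, 0) - u (q0, 0)"
      by (simp add: W_def)
    ultimately have "W z0 < u (p0, 0) - u (q0, 0) + \<theta> / 4"
      by linarith
    also have "\<dots> \<le> L * smooth_dL e p0 q0 + \<theta> / 4"
      using init[of p0 q0] mult_left_mono[OF dL_le_smooth_dL[OF pos(2), of p0 q0], of L] L by linarith
    finally have "W z0 < L * smooth_dL e p0 q0 + \<theta> / 4" .
    moreover have "\<alpha> * smooth_dL 1 0 p0 \<ge> 0" "n * (t0 - s0)\<^sup>2 \<ge> 0" "\<eta> * exp (k * (t0 - \<tau>)) > 0"
      using \<alpha> n pos smooth_dL_nonneg by auto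
    moreover have "\<Phi> z0 = W z0 - L * smooth_dL e p0 q0 - \<alpha> * smooth_dL 1 0 p0
        - n * (t0 - s0)\<^sup>2 - \<eta> * exp (k * (t0 - \<tau>))"
      by (simp add: \<Phi>_def z0_eq)
    ultimately have "\<Phi> z0 < \<theta> / 4"
      by linarith
    then show False using z0(2)[OF z1] \<Phi>z1 by linarith
  qed
  then have t0s0: "0 < t0" "0 < s0" using ts by auto

  define A where "A = L *\<^sub>R hgrad_smooth_dL e q0 p0"
  \<comment> \<open>The terms of \<Phi> subtracted from \<open>u (p, t)\<close> when
    \<open>q0\<close> and \<open>s0\<close> are frozen, up to a constant.\<close>
  define \<phi> where "\<phi> = (\<lambda>z. L * smooth_dL e q0 (fst z) + \<alpha> * smooth_dL 1 0 (fst z)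
    + (n * (snd z - s0)\<^sup>2 + \<eta> * exp (k * (snd z - \<tau>))))"
  have "C2 \<phi>"
  proof -
    have eq: "\<phi> = (\<lambda>z. (L * smooth_dL e q0 (fst z) + \<alpha> * smooth_dL 1 0 (fst z))
      + (n * (snd z + - s0)\<^sup>2 + \<eta> * exp (k * (snd z + - \<tau>))))" by (simp add: \<phi>_def)
    show ?thesis
      unfolding eq using pos by (intro C2_add C2_cmult C2_smooth_dL C2_power2 C2_exp C2_const C2_bounded_linear)
        (auto intro!: bounded_linear_intros)
  qed
  moreover have "\<forall>\<^sub>F z in nhds (p0, t0). u z - \<phi> z \<le> u (p0, t0) - \<phi> (p0, t0)"
  proof (rule eventually_nhds_snd_in[where T = "{0<..<T}"])
    fix p t assume "t \<in> {0<..<T}"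
    then have "\<Phi> ((p, q0), (t, s0)) \<le> \<Phi> z0" using ts by (intro z0(2)) (auto simp: S_def)
    then show "u (p, t) - \<phi> (p, t) \<le> u (p0, t0) - \<phi> (p0, t0)"
      by (simp add: \<Phi>_eq z0_eq \<phi>_def smooth_dL_commute[of e _ q0])
  qed (use t0s0 lt in auto)
  ultimately have "hj_operator m \<phi> p0 t0 \<le> 0"
    using sub t0s0(1) C2_imp_C2_near unfolding viscosity_subsolution_def by blast
  moreover have "hj_operator m \<phi> p0 t0 = (2 * n * (t0 - s0) + \<eta> * k * exp (k * (t0 - \<tau>)))
      + m (norm (A + \<alpha> *\<^sub>R hgrad_smooth_dL 1 0 p0))"
    unfolding \<phi>_def A_def
    by (rule hj_operator_smooth_dL[OF pos(2)]) (auto intro!: derivative_eq_intros)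
  ultimately have le: "2 * n * (t0 - s0) + \<eta> * k * exp (k * (t0 - \<tau>))
      + m (norm (A + \<alpha> *\<^sub>R hgrad_smooth_dL 1 0 p0)) \<le> 0" by simp

  \<comment> \<open>With \<open>p0\<close> and \<open>t0\<close> frozen, \<open>u (q, s)\<close>
    enters \<Phi> negatively, so the penalties change sign and the maximum becomes a minimum of
    \<open>u - \<omega>\<close>. The zero term gives the shape required by
    \<open>hj_operator_smooth_dL\<close>.\<close>
  define \<omega> where "\<omega> = (\<lambda>z. (- L) * smooth_dL e p0 (fst z) + 0 * smooth_dL 1 0 (fst z)
    + (- n) * (t0 - snd z)\<^sup>2)"
  have "C2 \<omega>"
  proof -
    have eq: "\<omega> = (\<lambda>z. ((- L) * smooth_dL e p0 (fst z) + 0 * smooth_dL 1 0 (fst z))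
      + (- n) * (t0 + (- 1) * snd z)\<^sup>2)" by (simp add: \<omega>_def)
    show ?thesis
      unfolding eq using pos by (intro C2_add C2_cmult C2_smooth_dL C2_power2 C2_exp C2_const C2_bounded_linear)
        (auto intro!: bounded_linear_intros)
  qed
  moreover have "\<forall>\<^sub>F z in nhds (q0, s0). u z - \<omega> z \<ge> u (q0, s0) - \<omega> (q0, s0)"
  proof (rule eventually_nhds_snd_in[where T = "{0<..<T}"])
    fix q s assume "s \<in> {0<..<T}"
    then have "\<Phi> ((p0, q), (t0, s)) \<le> \<Phi> z0" using ts by (intro z0(2)) (auto simp: S_def)
    then show "u (q, s) - \<omega> (q, s) \<ge> u (q0, s0) - \<omega> (q0, s0)"
      by (simp add: \<Phi>_eq z0_eq \<omega>_def)
  qed (use t0s0 lt in auto)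
  ultimately have "hj_operator m \<omega> q0 s0 \<ge> 0"
    using super t0s0(2) C2_imp_C2_near unfolding viscosity_supersolution_def by blast
  moreover have "hj_operator m \<omega> q0 s0 = 2 * n * (t0 - s0)
      + m (norm ((- L) *\<^sub>R hgrad_smooth_dL e p0 q0 + 0 *\<^sub>R hgrad_smooth_dL 1 0 q0))"
    unfolding \<omega>_def
    by (rule hj_operator_smooth_dL[OF pos(2)]) (auto intro!: derivative_eq_intros simp: algebra_simps)
  moreover have "norm ((- L) *\<^sub>R hgrad_smooth_dL e p0 q0 + 0 *\<^sub>R hgrad_smooth_dL 1 0 q0) = norm A"
    using norm_hgrad_smooth_dL_commute[of e p0 q0] by (simp add: A_def)
  ultimately have ge: "2 * n * (t0 - s0) + m (norm A) \<ge> 0" by simp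

  have nA: "norm A \<le> L"
    using norm_hgrad_smooth_dL_le[OF pos(2), of q0 p0] L by (simp add: A_def mult_left_le)
  have nB: "norm (\<alpha> *\<^sub>R hgrad_smooth_dL 1 0 p0) \<le> \<alpha>"
    using norm_hgrad_smooth_dL_le[of 1 0 p0] \<alpha> by (simp add: mult_left_le)
  have diff: "\<bar>norm A - norm (A + \<alpha> *\<^sub>R hgrad_smooth_dL 1 0 p0)\<bar> \<le> \<alpha>"
    using norm_triangle_ineq3[of A "A + \<alpha> *\<^sub>R hgrad_smooth_dL 1 0 p0"] nB by simp
  have "\<bar>m (norm A) - m (norm (A + \<alpha> *\<^sub>R hgrad_smooth_dL 1 0 p0))\<bar> < \<sigma>"
    by (rule \<rho>(2)) (use nA diff \<alpha> in auto)
  \<comment> \<open>Subtracting the two viscosity inequalities cancels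
    \<open>2 * n * (t0 - s0)\<close>.\<close>
  then have "\<eta> * k * exp (k * (t0 - \<tau>)) < \<sigma>" using le ge by linarith
  moreover have "\<eta> * k * exp (k * (t0 - \<tau>)) \<ge> \<sigma>"
    unfolding \<sigma>_def using pos t0s0(1)
    by (intro mult_left_mono) (auto simp: algebra_simps)
  ultimately show False by linarith
qed

section \<open>Continuity of the Hamiltonian and the two-sided estimate\<close>

lemma locally_uniformly_continuous_imp_continuous:
  assumes "locally_uniformly_continuous m"
  shows "continuous_on UNIV m"
proof (intro continuous_at_imp_continuous_on ballI)
  fix x :: real
  obtain r where "r > 0" "uniformly_continuous_on (ball x r) m"
    using assms unfolding locally_uniformly_continuous_def by blast
  then show "isCont m x"
    using uniformly_continuous_imp_continuous continuous_on_eq_continuous_at[of "ball x r" m] by auto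
qed

theorem theorem4p4:
  fixes m :: "real \<Rightarrow> real"
    and u :: "heis \<times> real \<Rightarrow> real"
    and u0 :: "heis \<Rightarrow> real"
    and L :: real
  assumes "locally_uniformly_continuous m"
    and "continuous_on (UNIV \<times> {0..}) u"
    and "viscosity_solution m u"
    and "\<And>T. T > 0 \<Longrightarrow> bounded (u ` (UNIV \<times> {0..<T}))"
    and "\<And>p. u (p, 0) = u0 p"
    and "bounded (range u0)"
    and "L > 0"
    and "\<And>p q. \<bar>u0 p - u0 q\<bar> \<le> L * dL p q"
  shows "\<forall>t\<ge>0. \<forall>p q. \<bar>u (p, t) - u (q, t)\<bar> \<le> L * dL p q"
proof (intro allI impI)
  fix t :: real and p q
  assume t: "t \<ge> 0"
  have init: "u (p, 0) - u (q, 0) \<le> L * dL p q" for p q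
    using assms(5) assms(8)[of p q] by (simp add: abs_le_iff)
  have le: "u (p, t) - u (q, t) \<le> L * dL p q" for p q
  proof (cases "t = 0")
    case False
    then show ?thesis
      using viscosity_solution_difference_le[of m u L t p q] init t assms(2,4,7)
        locally_uniformly_continuous_imp_continuous[OF assms(1)]
        assms(3)[unfolded viscosity_solution_def] by auto
  qed (use init in simp)
  show "\<bar>u (p, t) - u (q, t)\<bar> \<le> L * dL p q"
    using le[of p q] le[of q p] by (simp add: dL_commute[of q p] abs_le_iff)
qed

end
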